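(* Let $\mu_1,\mu_2>0$, $q>0$, and let $a>1$, $b>1$, $c\ge0$ satisfy $(a-1)(b-1)\ge(c-1)^2$. Suppose that $Q_a>|\zeta_a|$ and $Q_b>|\zeta_b|$. Then an optimal distribution for the problem $$v_P(q;\theta)=\sup_{\mathbb P\in\mathcal F(\theta)}\mathbb E_{\mathbb P}[(X_1+X_2-q)_+]$$ is the one taking the values $$x^{(1)}=\left((1-t_0)\tfrac{U_a}{U_c}\mu_1,\ t_1\right)\ \text{with probability}\ p_1=\frac{U_b\mu_2}{2Q_ct_1},$$ $$x^{(2)}=(q-Q_c,\,0)\ \text{with probability}\ p_2=\frac{U_a\mu_1}{2Q_ct_1}t_0,$$ $$x^{(3)}=(0,\,q+Q_c)\ \text{with probability}\ p_3=\frac{V_b\mu_2}{2Q_ct_2}t_0,$$ $$x^{(4)}=\left(t_2,\ (1-t_0)\tfrac{V_b}{V_c}\mu_2\right)\ \text{with probability}\ p_4=\frac{V_a\mu_1}{2Q_ct_2}.$$ The optimal value is $v_P(q;\theta)=\frac12V_c$.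
   Context: $(t)_+=\max\{t,0\}$. $\theta=(\mu_1,\mu_2,a\mu_1^2,b\mu_2^2,c\mu_1\mu_2)$, and $\mathcal F(\theta)$ is the set of all probability distributions $\mathbb P$ of a random vector $(X_1,X_2)$ supported on $\mathbb R_+^2=[0,\infty)^2$ such that $\mathbb E_{\mathbb P}[X_1]=\mu_1$, $\mathbb E_{\mathbb P}[X_2]=\mu_2$, $\mathbb E_{\mathbb P}[X_1^2]=a\mu_1^2$, $\mathbb E_{\mathbb P}[X_2^2]=b\mu_2^2$, $\mathbb E_{\mathbb P}[X_1X_2]=c\mu_1\mu_2$. "Optimal distribution" means a distribution belonging to $\mathcal F(\theta)$ at which the supremum is attained. Notation: $$Q_a=\sqrt{q^2-2q\tfrac{a-c}{a-1}\mu_2+\tfrac{ab-c^2}{a-1}\mu_2^2},\quad Q_b=\sqrt{q^2-2q\tfrac{b-c}{b-1}\mu_1+\tfrac{ab-c^2}{b-1}\mu_1^2},$$ $$Q_c=\sqrt{q^2-2q(\mu_1+\mu_2)+a\mu_1^2+b\mu_2^2+2c\mu_1\mu_2},$$ $\zeta_a=a\mu_1+c\mu_2-q$, $\zeta_b=c\mu_1+b\mu_2-q$; $U_a=(q+Q_c)-(a\mu_1+c\mu_2)$, $V_a=(a\mu_1+c\mu_2)-(q-Q_c)$, $U_b=(q+Q_c)-(b\mu_2+c\mu_1)$, $V_b=(b\mu_2+c\mu_1)-(q-Q_c)$, $U_c=(q+Q_c)-(\mu_1+\mu_2)$, $V_c=(\mu_1+\mu_2)-(q-Q_c)$; $$t_0=\frac{\det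 M}{\det M+c\mu_1\mu_2\,U_cV_c},\quad t_1=\frac{U_b}{U_c}\mu_2+t_0\frac{U_a}{U_c}\mu_1,\quad t_2=\frac{V_a}{V_c}\mu_1+t_0\frac{V_b}{V_c}\mu_2,$$ where $M=\begin{pmatrix}(a-1)\mu_1^2&(c-1)\mu_1\mu_2\\(c-1)\mu_1\mu_2&(b-1)\mu_2^2\end{pmatrix}$ is the covariance matrix. *)

theory Defs
  imports "HOL-Probability.Probability"
begin

text \<open>
  The set of laws on the nonnegative quadrant with prescribed first and second moments.
  The parameter lists, in this order, the values of
  \<open>E[X\<^sub>1]\<close>, \<open>E[X\<^sub>2]\<close>, \<open>E[X\<^sub>1\<^sup>2]\<close>, \<open>E[X\<^sub>2\<^sup>2]\<close> and \<open>E[X\<^sub>1 X\<^sub>2]\<close>.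
  Using \<^const>\<open>has_bochner_integral\<close> rather than an equation between integrals
  includes the existence of the moments, since the Bochner integral of a
  non-integrable function is 0.
\<close>

definition moment_class :: "real \<times> real \<times> real \<times> real \<times> real \<Rightarrow> (real \<times> real) measure set" where
  "moment_class = (\<lambda>(m\<^sub>1, m\<^sub>2, s\<^sub>1, s\<^sub>2, s\<^sub>1\<^sub>2). {P.
     prob_space P \<and> sets P = sets borel \<and>
     (AE x in P. 0 \<le> fst x \<and> 0 \<le> snd x) \<and>
     has_bochner_integral P (\<lambda>x. fst x) m\<^sub>1 \<and>
     has_bochner_integral P (\<lambda>x. snd x) m\<^sub>2 \<and>
     has_bochner_integral P (\<lambda>x. (fst x)\<^sup>2) s\<^sub>1 \<and>
     has_bochner_integral P (\<lambda>x. (snd x)\<^sup>2) s\<^sub>2 \<and>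
     has_bochner_integral P (\<lambda>x. fst x * snd x) s\<^sub>1\<^sub>2})"

definition expected_excess :: "real \<Rightarrow> (real \<times> real) measure \<Rightarrow> real" where
  "expected_excess q P = integral\<^sup>L P (\<lambda>x. max (fst x + snd x - q) 0)"

text \<open>
  The supremum is taken in \<^typ>\<open>ereal\<close>, where it needs no boundedness or nonemptiness
  hypothesis to be meaningful.
\<close>

definition v_P :: "real \<Rightarrow> real \<times> real \<times> real \<times> real \<times> real \<Rightarrow> ereal" where
  "v_P q \<theta> = (SUP P \<in> moment_class \<theta>. ereal (expected_excess q P))"

definition optimal_distribution ::
    "real \<Rightarrow> real \<times> real \<times> real \<times> real \<times> real \<Rightarrow> (real \<times> real) measure \<Rightarrow> bool" where
  "optimal_distribution q \<theta> P \<longleftrightarrow>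
     P \<in> moment_class \<theta> \<and> ereal (expected_excess q P) = v_P q \<theta>"

text \<open>
  The law taking each listed value with the listed probability; probabilities of
  repeated values add up. It has this meaning only for lists that satisfy
  \<^const>\<open>pmf_of_list_wf\<close> (nonnegative probabilities with sum 1).
\<close>

definition discrete_law :: "((real \<times> real) \<times> real) list \<Rightarrow> (real \<times> real) measure" where
  "discrete_law xs = distr (measure_pmf (pmf_of_list xs)) borel (\<lambda>x. x)"

definition Q_a :: "real \<Rightarrow> real \<Rightarrow> real \<Rightarrow> real \<Rightarrow> real \<Rightarrow> real \<Rightarrow> real" where
  "Q_a \<mu>\<^sub>1 \<mu>\<^sub>2 a b c q =
     sqrt (q\<^sup>2 - 2 * q * ((a - c) / (a - 1)) * \<mu>\<^sub>2 + (a * b - c\<^sup>2) / (a - 1) * \<mu>\<^sub>2\<^sup>2)"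

definition Q_b :: "real \<Rightarrow> real \<Rightarrow> real \<Rightarrow> real \<Rightarrow> real \<Rightarrow> real \<Rightarrow> real" where
  "Q_b \<mu>\<^sub>1 \<mu>\<^sub>2 a b c q =
     sqrt (q\<^sup>2 - 2 * q * ((b - c) / (b - 1)) * \<mu>\<^sub>1 + (a * b - c\<^sup>2) / (b - 1) * \<mu>\<^sub>1\<^sup>2)"

definition Q_c :: "real \<Rightarrow> real \<Rightarrow> real \<Rightarrow> real \<Rightarrow> real \<Rightarrow> real \<Rightarrow> real" where
  "Q_c \<mu>\<^sub>1 \<mu>\<^sub>2 a b c q =
     sqrt (q\<^sup>2 - 2 * q * (\<mu>\<^sub>1 + \<mu>\<^sub>2) + a * \<mu>\<^sub>1\<^sup>2 + b * \<mu>\<^sub>2\<^sup>2 + 2 * c * \<mu>\<^sub>1 * \<mu>\<^sub>2)"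

definition \<zeta>_a :: "real \<Rightarrow> real \<Rightarrow> real \<Rightarrow> real \<Rightarrow> real \<Rightarrow> real \<Rightarrow> real" where
  "\<zeta>_a \<mu>\<^sub>1 \<mu>\<^sub>2 a b c q = a * \<mu>\<^sub>1 + c * \<mu>\<^sub>2 - q"

definition \<zeta>_b :: "real \<Rightarrow> real \<Rightarrow> real \<Rightarrow> real \<Rightarrow> real \<Rightarrow> real \<Rightarrow> real" where
  "\<zeta>_b \<mu>\<^sub>1 \<mu>\<^sub>2 a b c q = c * \<mu>\<^sub>1 + b * \<mu>\<^sub>2 - q"

definition U_a :: "real \<Rightarrow> real \<Rightarrow> real \<Rightarrow> real \<Rightarrow> real \<Rightarrow> real \<Rightarrow> real" where
  "U_a \<mu>\<^sub>1 \<mu>\<^sub>2 a b c q = (q + Q_c \<mu>\<^sub>1 \<mu>\<^sub>2 a b c q) - (a * \<mu>\<^sub>1 + c * \<mu>\<^sub>2)"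

definition V_a :: "real \<Rightarrow> real \<Rightarrow> real \<Rightarrow> real \<Rightarrow> real \<Rightarrow> real \<Rightarrow> real" where
  "V_a \<mu>\<^sub>1 \<mu>\<^sub>2 a b c q = (a * \<mu>\<^sub>1 + c * \<mu>\<^sub>2) - (q - Q_c \<mu>\<^sub>1 \<mu>\<^sub>2 a b c q)"

definition U_b :: "real \<Rightarrow> real \<Rightarrow> real \<Rightarrow> real \<Rightarrow> real \<Rightarrow> real \<Rightarrow> real" where
  "U_b \<mu>\<^sub>1 \<mu>\<^sub>2 a b c q = (q + Q_c \<mu>\<^sub>1 \<mu>\<^sub>2 a b c q) - (b * \<mu>\<^sub>2 + c * \<mu>\<^sub>1)"

definition V_b :: "real \<Rightarrow> real \<Rightarrow> real \<Rightarrow> real \<Rightarrow> real \<Rightarrow> real \<Rightarrow> real" where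
  "V_b \<mu>\<^sub>1 \<mu>\<^sub>2 a b c q = (b * \<mu>\<^sub>2 + c * \<mu>\<^sub>1) - (q - Q_c \<mu>\<^sub>1 \<mu>\<^sub>2 a b c q)"

definition U_c :: "real \<Rightarrow> real \<Rightarrow> real \<Rightarrow> real \<Rightarrow> real \<Rightarrow> real \<Rightarrow> real" where
  "U_c \<mu>\<^sub>1 \<mu>\<^sub>2 a b c q = (q + Q_c \<mu>\<^sub>1 \<mu>\<^sub>2 a b c q) - (\<mu>\<^sub>1 + \<mu>\<^sub>2)"

definition V_c :: "real \<Rightarrow> real \<Rightarrow> real \<Rightarrow> real \<Rightarrow> real \<Rightarrow> real \<Rightarrow> real" where
  "V_c \<mu>\<^sub>1 \<mu>\<^sub>2 a b c q = (\<mu>\<^sub>1 + \<mu>\<^sub>2) - (q - Q_c \<mu>\<^sub>1 \<mu>\<^sub>2 a b c q)"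

definition cov_matrix :: "real \<Rightarrow> real \<Rightarrow> real \<Rightarrow> real \<Rightarrow> real \<Rightarrow> real^2^2" where
  "cov_matrix \<mu>\<^sub>1 \<mu>\<^sub>2 a b c =
     vector [vector [(a - 1) * \<mu>\<^sub>1\<^sup>2, (c - 1) * \<mu>\<^sub>1 * \<mu>\<^sub>2],
             vector [(c - 1) * \<mu>\<^sub>1 * \<mu>\<^sub>2, (b - 1) * \<mu>\<^sub>2\<^sup>2]]"

definition t\<^sub>0 :: "real \<Rightarrow> real \<Rightarrow> real \<Rightarrow> real \<Rightarrow> real \<Rightarrow> real \<Rightarrow> real" where
  "t\<^sub>0 \<mu>\<^sub>1 \<mu>\<^sub>2 a b c q =
     det (cov_matrix \<mu>\<^sub>1 \<mu>\<^sub>2 a b c) /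
     (det (cov_matrix \<mu>\<^sub>1 \<mu>\<^sub>2 a b c) + c * \<mu>\<^sub>1 * \<mu>\<^sub>2 * (U_c \<mu>\<^sub>1 \<mu>\<^sub>2 a b c q * V_c \<mu>\<^sub>1 \<mu>\<^sub>2 a b c q))"

definition t\<^sub>1 :: "real \<Rightarrow> real \<Rightarrow> real \<Rightarrow> real \<Rightarrow> real \<Rightarrow> real \<Rightarrow> real" where
  "t\<^sub>1 \<mu>\<^sub>1 \<mu>\<^sub>2 a b c q =
     U_b \<mu>\<^sub>1 \<mu>\<^sub>2 a b c q / U_c \<mu>\<^sub>1 \<mu>\<^sub>2 a b c q * \<mu>\<^sub>2 +
     t\<^sub>0 \<mu>\<^sub>1 \<mu>\<^sub>2 a b c q * (U_a \<mu>\<^sub>1 \<mu>\<^sub>2 a b c q / U_c \<mu>\<^sub>1 \<mu>\<^sub>2 a b c q) * \<mu>\<^sub>1"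

definition t\<^sub>2 :: "real \<Rightarrow> real \<Rightarrow> real \<Rightarrow> real \<Rightarrow> real \<Rightarrow> real \<Rightarrow> real" where
  "t\<^sub>2 \<mu>\<^sub>1 \<mu>\<^sub>2 a b c q =
     V_a \<mu>\<^sub>1 \<mu>\<^sub>2 a b c q / V_c \<mu>\<^sub>1 \<mu>\<^sub>2 a b c q * \<mu>\<^sub>1 +
     t\<^sub>0 \<mu>\<^sub>1 \<mu>\<^sub>2 a b c q * (V_b \<mu>\<^sub>1 \<mu>\<^sub>2 a b c q / V_c \<mu>\<^sub>1 \<mu>\<^sub>2 a b c q) * \<mu>\<^sub>2"

end

theory Submission
  imports Defs
begin

text \<open>
  For \<open>Q > 0\<close> the convex parabola \<open>(s - q + Q)\<^sup>2 / (4 * Q)\<close> lies above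
  \<open>max (s - q) 0\<close> and touches it exactly at \<open>s = q - Q\<close> and \<open>s = q + Q\<close>. Taking
  \<open>s = X\<^sub>1 + X\<^sub>2\<close> and integrating bounds the expected excess by the first two moments of the sum,
  and \<open>Q = Q\<^sub>c\<close> makes the bound \<open>V\<^sub>c / 2\<close>. The proposed law lives on the two lines
  \<open>X\<^sub>1 + X\<^sub>2 = q \<plusminus> Q\<^sub>c\<close>, so it attains the bound; \<open>t\<^sub>0\<close> is the one free parameter left for
  adjusting the mixed moment. The hypotheses on \<open>Q\<^sub>a\<close> and \<open>Q\<^sub>b\<close> amount to
  \<open>\<bar>\<zeta>\<^sub>a\<bar> < Q\<^sub>c\<close> and \<open>\<bar>\<zeta>\<^sub>b\<bar> < Q\<^sub>c\<close>, i.e. to positivity of \<open>U\<^sub>a, V\<^sub>a, U\<^sub>b, V\<^sub>b\<close>, which makes the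
  atoms and the weights nonnegative.
\<close>

section \<open>Laws given by finite lists of weighted atoms\<close>

lemma sum_mult_sum_list_filter_fst:
  fixes f :: "'a \<Rightarrow> real"
  assumes "finite A" "fst ` set xs \<subseteq> A"
  shows "(\<Sum>a\<in>A. f a * sum_list (map snd (filter (\<lambda>z. fst z = a) xs))) =
         sum_list (map (\<lambda>(x, p). f x * p) xs)"
  using assms(2)
proof (induction xs)
  case (Cons z xs)
  have "(\<Sum>a\<in>A. f a * sum_list (map snd (filter (\<lambda>z. fst z = a) (z # xs)))) =
        (\<Sum>a\<in>A. (if fst z = a then f a * snd z else 0) +
                f a * sum_list (map snd (filter (\<lambda>z. fst z = a) xs)))"
    by (intro sum.cong) (auto simp: algebra_simps)
  also have "\<dots> = f (fst z) * snd z + sum_list (map (\<lambda>(x, p). f x * p) xs)"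
    using Cons assms(1) by (simp add: sum.distrib)
  finally show ?case
    by (simp add: case_prod_unfold)
qed simp

lemma expectation_pmf_of_list:
  fixes f :: "'a \<Rightarrow> real"
  assumes "pmf_of_list_wf xs"
  shows "measure_pmf.expectation (pmf_of_list xs) f = sum_list (map (\<lambda>(x, p). f x * p) xs)"
proof -
  have "measure_pmf.expectation (pmf_of_list xs) f =
        (\<Sum>a\<in>set (map fst xs). f a * pmf (pmf_of_list xs) a)"
    using set_pmf_of_list[OF assms] by (intro integral_measure_pmf_real) auto
  \<comment> \<open>\<open>pmf_of_list\<close> merges the weights of equal values, so its sum over
    values has to be regrouped into a sum over list entries.\<close>
  also have "\<dots> = sum_list (map (\<lambda>(x, p). f x * p) xs)"
    unfolding pmf_pmf_of_list[OF assms] by (intro sum_mult_sum_list_filter_fst) auto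
  finally show ?thesis .
qed

lemma has_bochner_integral_discrete_law:
  fixes f :: "real \<times> real \<Rightarrow> real"
  assumes "pmf_of_list_wf xs" "f \<in> borel_measurable borel"
  shows "has_bochner_integral (discrete_law xs) f (sum_list (map (\<lambda>(x, p). f x * p) xs))"
proof -
  have "integrable (measure_pmf (pmf_of_list xs)) f"
    by (rule integrable_measure_pmf_finite[OF finite_set_pmf_of_list[OF assms(1)]])
  then have "has_bochner_integral (measure_pmf (pmf_of_list xs)) f
      (sum_list (map (\<lambda>(x, p). f x * p) xs))"
    by (simp add: has_bochner_integral_iff expectation_pmf_of_list assms(1))
  then show ?thesis
    unfolding discrete_law_def using assms(2)
    by (intro has_bochner_integral_distr) auto
qed

lemma discrete_law_in_moment_class:
  assumes wf: "pmf_of_list_wf xs"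
    and nonneg: "\<And>x p. (x, p) \<in> set xs \<Longrightarrow> 0 \<le> fst x \<and> 0 \<le> snd x"
    and "sum_list (map (\<lambda>(x, p). fst x * p) xs) = m\<^sub>1"
    and "sum_list (map (\<lambda>(x, p). snd x * p) xs) = m\<^sub>2"
    and "sum_list (map (\<lambda>(x, p). (fst x)\<^sup>2 * p) xs) = s\<^sub>1"
    and "sum_list (map (\<lambda>(x, p). (snd x)\<^sup>2 * p) xs) = s\<^sub>2"
    and "sum_list (map (\<lambda>(x, p). fst x * snd x * p) xs) = s\<^sub>1\<^sub>2"
  shows "discrete_law xs \<in> moment_class (m\<^sub>1, m\<^sub>2, s\<^sub>1, s\<^sub>2, s\<^sub>1\<^sub>2)"
proof -
  have "prob_space (discrete_law xs)"
    unfolding discrete_law_def by (rule measure_pmf.prob_space_distr) simp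
  moreover have "AE x in discrete_law xs. 0 \<le> fst x \<and> 0 \<le> snd x"
  proof -
    have "{x :: real \<times> real. 0 \<le> fst x \<and> 0 \<le> snd x} \<in> sets borel"
      by (intro borel_closed closed_Collect_conj closed_Collect_le continuous_intros)
    then show ?thesis
      unfolding discrete_law_def using set_pmf_of_list[OF wf] nonneg
      by (subst AE_distr_iff) (auto simp: AE_measure_pmf_iff)
  qed
  moreover have "has_bochner_integral (discrete_law xs) (\<lambda>x. fst x) m\<^sub>1"
    "has_bochner_integral (discrete_law xs) (\<lambda>x. snd x) m\<^sub>2"
    "has_bochner_integral (discrete_law xs) (\<lambda>x. (fst x)\<^sup>2) s\<^sub>1"
    "has_bochner_integral (discrete_law xs) (\<lambda>x. (snd x)\<^sup>2) s\<^sub>2"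
    "has_bochner_integral (discrete_law xs) (\<lambda>x. fst x * snd x) s\<^sub>1\<^sub>2"
    unfolding assms(3-7)[symmetric]
    by (rule has_bochner_integral_discrete_law[OF wf];
        simp add: borel_measurable_continuous_onI continuous_intros)+
  moreover have "sets (discrete_law xs) = sets borel"
    by (simp add: discrete_law_def)
  ultimately show ?thesis
    by (simp add: moment_class_def)
qed

lemma expected_excess_discrete_law:
  assumes "pmf_of_list_wf xs"
  shows "expected_excess q (discrete_law xs) =
         sum_list (map (\<lambda>(x, p). max (fst x + snd x - q) 0 * p) xs)"
  unfolding expected_excess_def
  by (intro has_bochner_integral_integral_eq has_bochner_integral_discrete_law assms
      borel_measurable_continuous_onI continuous_intros)

section \<open>Upper bound for the expected excess\<close>

lemma max_diff_le_parabola: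
  fixes s q Q :: real
  assumes "Q > 0"
  shows "max (s - q) 0 \<le> (s - q + Q)\<^sup>2 / (4 * Q)"
proof -
  have "4 * Q * (s - q) \<le> (s - q + Q)\<^sup>2"
    using zero_le_power2[of "s - q - Q"] by (simp add: power2_eq_square algebra_simps)
  then show ?thesis
    using assms by (simp add: pos_le_divide_eq mult.commute)
qed

text \<open>With \<open>S = X\<^sub>1 + X\<^sub>2\<close>, the parabola integrates to
  \<open>(E[(S - q)\<^sup>2] + Q\<^sup>2) / (4 * Q) + (m\<^sub>1 + m\<^sub>2 - q) / 2\<close>. The
  prescribed \<open>Q\<^sup>2 = E[(S - q)\<^sup>2]\<close> minimises this over \<open>Q > 0\<close>
  and turns the first term into \<open>Q / 2\<close>.\<close>

lemma expected_excess_le: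
  assumes P: "P \<in> moment_class (m\<^sub>1, m\<^sub>2, s\<^sub>1, s\<^sub>2, s\<^sub>1\<^sub>2)"
    and Q: "Q > 0" "Q\<^sup>2 = q\<^sup>2 - 2 * q * (m\<^sub>1 + m\<^sub>2) + s\<^sub>1 + s\<^sub>2 + 2 * s\<^sub>1\<^sub>2"
  shows "expected_excess q P \<le> (m\<^sub>1 + m\<^sub>2 - (q - Q)) / 2"
proof -
  from P interpret prob_space P by (simp add: moment_class_def)
  let ?d = "Q - q"
  \<comment> \<open>The parabola is expanded into the monomials whose integrals
    \<open>moment_class\<close> prescribes.\<close>
  let ?f = "\<lambda>x::real \<times> real. (1 / (4 * Q)) * ((fst x)\<^sup>2 + (snd x)\<^sup>2 + 2 * (fst x * snd x)
      + (2 * ?d) * fst x + (2 * ?d) * snd x + ?d\<^sup>2)"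
  have "has_bochner_integral P (\<lambda>x. ?d\<^sup>2) (?d\<^sup>2)"
    by (simp add: has_bochner_integral_iff prob_space)
  then have f: "has_bochner_integral P ?f
      ((1 / (4 * Q)) * (s\<^sub>1 + s\<^sub>2 + 2 * s\<^sub>1\<^sub>2 + (2 * ?d) * m\<^sub>1 + (2 * ?d) * m\<^sub>2 + ?d\<^sup>2))"
    using P by (intro has_bochner_integral_mult_right has_bochner_integral_add)
      (auto simp: moment_class_def)
  have "expected_excess q P \<le> integral\<^sup>L P ?f"
    unfolding expected_excess_def
  proof (rule integral_mono)
    show "integrable P (\<lambda>x. max (fst x + snd x - q) 0)"
      using P by (intro integrable_max Bochner_Integration.integrable_diff
          Bochner_Integration.integrable_add) (auto simp: moment_class_def has_bochner_integral_iff)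
    show "integrable P ?f"
      using f by (simp add: has_bochner_integral_iff)
    fix x :: "real \<times> real"
    have "(fst x)\<^sup>2 + (snd x)\<^sup>2 + 2 * (fst x * snd x)
        + (2 * ?d) * fst x + (2 * ?d) * snd x + ?d\<^sup>2 = (fst x + snd x - q + Q)\<^sup>2"
      by (simp add: power2_eq_square algebra_simps)
    then have eq: "?f x = (fst x + snd x - q + Q)\<^sup>2 / (4 * Q)"
      by simp
    show "max (fst x + snd x - q) 0 \<le> ?f x"
      unfolding eq by (rule max_diff_le_parabola[OF Q(1)])
  qed
  also have "\<dots> = (1 / (4 * Q)) * (s\<^sub>1 + s\<^sub>2 + 2 * s\<^sub>1\<^sub>2 + (2 * ?d) * m\<^sub>1 + (2 * ?d) * m\<^sub>2 + ?d\<^sup>2)"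
    using f by (simp add: has_bochner_integral_iff)
  also have "s\<^sub>1 + s\<^sub>2 + 2 * s\<^sub>1\<^sub>2 + (2 * ?d) * m\<^sub>1 + (2 * ?d) * m\<^sub>2 + ?d\<^sup>2 =
      2 * Q * (m\<^sub>1 + m\<^sub>2 - (q - Q))"
    using Q(2) by (simp add: power2_eq_square algebra_simps)
  finally show ?thesis
    using Q(1) by simp
qed

section \<open>Comparison of the square roots\<close>

lemma Q_c_swap: "Q_c \<mu>\<^sub>2 \<mu>\<^sub>1 b a c q = Q_c \<mu>\<^sub>1 \<mu>\<^sub>2 a b c q"
  by (simp add: Q_c_def algebra_simps)

text \<open>The radicands \<open>A\<close> of \<open>Q_a\<close> and \<open>C\<close> of
  \<open>Q_c\<close> satisfy \<open>a * (C - z\<^sup>2) = (a - 1) * (A - z\<^sup>2)\<close> with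
  \<open>z = \<zeta>_a\<close>, so both differences have the same sign.\<close>

lemma Q_c_dominates_\<zeta>_a:
  assumes "a > 1" "Q_a \<mu>\<^sub>1 \<mu>\<^sub>2 a b c q > \<bar>\<zeta>_a \<mu>\<^sub>1 \<mu>\<^sub>2 a b c q\<bar>"
  shows "Q_c \<mu>\<^sub>1 \<mu>\<^sub>2 a b c q > \<bar>\<zeta>_a \<mu>\<^sub>1 \<mu>\<^sub>2 a b c q\<bar>"
proof -
  define A where "A = q\<^sup>2 - 2 * q * ((a - c) / (a - 1)) * \<mu>\<^sub>2 + (a * b - c\<^sup>2) / (a - 1) * \<mu>\<^sub>2\<^sup>2"
  define C where "C = q\<^sup>2 - 2 * q * (\<mu>\<^sub>1 + \<mu>\<^sub>2) + a * \<mu>\<^sub>1\<^sup>2 + b * \<mu>\<^sub>2\<^sup>2 + 2 * c * \<mu>\<^sub>1 * \<mu>\<^sub>2"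
  define z where "z = \<zeta>_a \<mu>\<^sub>1 \<mu>\<^sub>2 a b c q"
  \<comment> \<open>In HOL \<open>sqrt\<close> is strictly increasing on the whole real line, so the
    inequality passes to the radicands before the sign of \<open>A\<close> is known.\<close>
  have "sqrt (z\<^sup>2) < sqrt A"
    using assms(2) by (simp add: Q_a_def A_def z_def)
  then have "z\<^sup>2 < A"
    by (simp only: real_sqrt_less_iff)
  define r where "r = (a - c) / (a - 1)"
  define s where "s = (a * b - c\<^sup>2) / (a - 1)"
  have rs: "(a - 1) * r = a - c" "(a - 1) * s = a * b - c\<^sup>2"
    using assms(1) by (simp_all add: r_def s_def)
  have "(a - 1) * A = (a - 1) * q\<^sup>2 - 2 * q * ((a - 1) * r) * \<mu>\<^sub>2 + ((a - 1) * s) * \<mu>\<^sub>2\<^sup>2"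
    unfolding A_def r_def[symmetric] s_def[symmetric] by (simp add: algebra_simps)
  then have "(a - 1) * A = (a - 1) * q\<^sup>2 - 2 * q * (a - c) * \<mu>\<^sub>2 + (a * b - c\<^sup>2) * \<mu>\<^sub>2\<^sup>2"
    unfolding rs .
  then have "a * (C - z\<^sup>2) = (a - 1) * (A - z\<^sup>2)"
    by (simp add: C_def z_def \<zeta>_a_def power2_eq_square algebra_simps)
  also have "\<dots> > 0"
    using assms(1) \<open>z\<^sup>2 < A\<close> by simp
  finally have "z\<^sup>2 < C"
    using assms(1) by (simp add: zero_less_mult_iff)
  then have "sqrt (z\<^sup>2) < sqrt C"
    by (simp only: real_sqrt_less_iff)
  then show ?thesis
    by (simp add: Q_c_def C_def z_def)
qed

text \<open>Mirror image of the previous comparison: exchanging the coordinates swaps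
  \<open>a\<close> with \<open>b\<close> and \<open>\<mu>\<^sub>1\<close> with
  \<open>\<mu>\<^sub>2\<close>, and fixes \<open>Q_c\<close>.\<close>

lemma Q_c_dominates_\<zeta>_b:
  assumes "b > 1" "Q_b \<mu>\<^sub>1 \<mu>\<^sub>2 a b c q > \<bar>\<zeta>_b \<mu>\<^sub>1 \<mu>\<^sub>2 a b c q\<bar>"
  shows "Q_c \<mu>\<^sub>1 \<mu>\<^sub>2 a b c q > \<bar>\<zeta>_b \<mu>\<^sub>1 \<mu>\<^sub>2 a b c q\<bar>"
proof -
  have "Q_b \<mu>\<^sub>1 \<mu>\<^sub>2 a b c q = Q_a \<mu>\<^sub>2 \<mu>\<^sub>1 b a c q" "\<zeta>_b \<mu>\<^sub>1 \<mu>\<^sub>2 a b c q = \<zeta>_a \<mu>\<^sub>2 \<mu>\<^sub>1 b a c q"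
    by (simp_all add: Q_a_def Q_b_def \<zeta>_a_def \<zeta>_b_def mult.commute add.commute)
  then show ?thesis
    using Q_c_dominates_\<zeta>_a[of b \<mu>\<^sub>2 \<mu>\<^sub>1 a c q] assms by (simp add: Q_c_swap)
qed

text \<open>A positive value of \<open>sqrt\<close> forces a positive radicand, so squaring undoes
  the root.\<close>

lemma Q_c_squared:
  assumes "Q_c \<mu>\<^sub>1 \<mu>\<^sub>2 a b c q > 0"
  shows "(Q_c \<mu>\<^sub>1 \<mu>\<^sub>2 a b c q)\<^sup>2 =
    q\<^sup>2 - 2 * q * (\<mu>\<^sub>1 + \<mu>\<^sub>2) + a * \<mu>\<^sub>1\<^sup>2 + b * \<mu>\<^sub>2\<^sup>2 + 2 * c * \<mu>\<^sub>1 * \<mu>\<^sub>2"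
  using assms unfolding Q_c_def by simp

text \<open>
  Here \<open>Q\<^sup>2 - (\<mu>\<^sub>1 + \<mu>\<^sub>2 - q)\<^sup>2\<close> is the variance of \<open>X\<^sub>1 + X\<^sub>2\<close>. If it vanished, \<open>X\<^sub>1\<close> would be
  uncorrelated with the sum, so that \<open>a * \<mu>\<^sub>1 + c * \<mu>\<^sub>2 = \<mu>\<^sub>1 + \<mu>\<^sub>2\<close>, against the hypothesis
  on \<open>\<zeta>\<^sub>a\<close>.
\<close>

lemma abs_mean_diff_less:
  fixes \<mu>\<^sub>1 \<mu>\<^sub>2 a b c q Q :: real
  assumes "a > 1" "(a - 1) * (b - 1) \<ge> (c - 1)\<^sup>2" "\<bar>a * \<mu>\<^sub>1 + c * \<mu>\<^sub>2 - q\<bar> < Q"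
    and Q: "Q\<^sup>2 = q\<^sup>2 - 2 * q * (\<mu>\<^sub>1 + \<mu>\<^sub>2) + a * \<mu>\<^sub>1\<^sup>2 + b * \<mu>\<^sub>2\<^sup>2 + 2 * c * \<mu>\<^sub>1 * \<mu>\<^sub>2"
  shows "\<bar>\<mu>\<^sub>1 + \<mu>\<^sub>2 - q\<bar> < Q"
proof -
  define v where "v = Q\<^sup>2 - (\<mu>\<^sub>1 + \<mu>\<^sub>2 - q)\<^sup>2"
  \<comment> \<open>\<open>\<mu>\<^sub>1 * w\<close> is the covariance of \<open>X\<^sub>1\<close>
    with the sum; \<open>eq\<close> below completes the square in the quadratic form of the
    covariance matrix.\<close>
  define w where "w = (a - 1) * \<mu>\<^sub>1 + (c - 1) * \<mu>\<^sub>2"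
  have eq: "(a - 1) * v = w\<^sup>2 + ((a - 1) * (b - 1) - (c - 1)\<^sup>2) * \<mu>\<^sub>2\<^sup>2"
    unfolding v_def w_def Q by (simp add: power2_eq_square algebra_simps)
  have "v > 0"
  proof (rule ccontr)
    assume "\<not> v > 0"
    then have "(a - 1) * v \<le> 0"
      using assms(1) by (simp add: mult_le_0_iff)
    moreover have "((a - 1) * (b - 1) - (c - 1)\<^sup>2) * \<mu>\<^sub>2\<^sup>2 \<ge> 0"
      using assms(2) by simp
    ultimately have "w = 0"
      using eq zero_le_power2[of w] by (smt (verit) zero_eq_power2)
    then have "a * \<mu>\<^sub>1 + c * \<mu>\<^sub>2 - q = \<mu>\<^sub>1 + \<mu>\<^sub>2 - q"
      by (simp add: w_def algebra_simps)
    then have "\<bar>\<mu>\<^sub>1 + \<mu>\<^sub>2 - q\<bar> < Q"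
      using assms(3) by simp
    then have "(\<mu>\<^sub>1 + \<mu>\<^sub>2 - q)\<^sup>2 < Q\<^sup>2"
      by (metis abs_ge_zero power2_abs power_strict_mono zero_less_numeral)
    then show False
      using \<open>\<not> v > 0\<close> by (simp add: v_def)
  qed
  then have "\<bar>\<mu>\<^sub>1 + \<mu>\<^sub>2 - q\<bar>\<^sup>2 < Q\<^sup>2"
    by (simp add: v_def)
  moreover have "Q \<ge> 0"
    using assms(3) by linarith
  ultimately show ?thesis
    by (rule power2_less_imp_less)
qed

text \<open>Here \<open>Q - x\<close>, \<open>Q - y\<close>, \<open>Q - z\<close> are
  \<open>U_a\<close>, \<open>U_b\<close>, \<open>U_c\<close>, and the sums with \<open>Q\<close> are
  the corresponding \<open>V\<close>. Up to a factor, the left side is the mixed moment of the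
  proposed law at \<open>t\<^sub>0 = 0\<close>; the right side is the denominator of
  \<open>t\<^sub>0\<close>, up to a factor.\<close>

lemma mixed_moment_identity:
  fixes \<mu>\<^sub>1 \<mu>\<^sub>2 a b c q Q :: real
  defines "x \<equiv> a * \<mu>\<^sub>1 + c * \<mu>\<^sub>2 - q" and "y \<equiv> b * \<mu>\<^sub>2 + c * \<mu>\<^sub>1 - q" and "z \<equiv> \<mu>\<^sub>1 + \<mu>\<^sub>2 - q"
  assumes Q: "Q\<^sup>2 = q\<^sup>2 - 2 * q * (\<mu>\<^sub>1 + \<mu>\<^sub>2) + a * \<mu>\<^sub>1\<^sup>2 + b * \<mu>\<^sub>2\<^sup>2 + 2 * c * \<mu>\<^sub>1 * \<mu>\<^sub>2"
  shows "(Q - x) * (Q - y) * (Q + z) + (Q + x) * (Q + y) * (Q - z) =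
    2 * Q * (((a - 1) * (b - 1) - (c - 1)\<^sup>2) * \<mu>\<^sub>1 * \<mu>\<^sub>2 + c * ((Q - z) * (Q + z)))"
proof -
  \<comment> \<open>The second product is minus the first evaluated at \<open>-Q\<close>, so only
    twice the part odd in \<open>Q\<close> survives.\<close>
  have "(Q - x) * (Q - y) * (Q + z) + (Q + x) * (Q + y) * (Q - z) =
      2 * Q * (Q\<^sup>2 + x * y - z * (x + y))"
    by (simp add: power2_eq_square algebra_simps)
  also have "Q\<^sup>2 + x * y - z * (x + y) =
      ((a - 1) * (b - 1) - (c - 1)\<^sup>2) * \<mu>\<^sub>1 * \<mu>\<^sub>2 + c * (Q\<^sup>2 - z\<^sup>2)"
    unfolding Q x_def y_def z_def by (simp add: power2_eq_square algebra_simps)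
  also have "Q\<^sup>2 - z\<^sup>2 = (Q - z) * (Q + z)"
    by (simp add: power2_eq_square algebra_simps)
  finally show ?thesis .
qed

lemma det_cov_matrix:
  "det (cov_matrix \<mu>\<^sub>1 \<mu>\<^sub>2 a b c) = ((a - 1) * (b - 1) - (c - 1)\<^sup>2) * (\<mu>\<^sub>1 * \<mu>\<^sub>2)\<^sup>2"
  by (simp add: cov_matrix_def det_2 power2_eq_square algebra_simps)

theorem lemmaB2p6:
  fixes \<mu>\<^sub>1 \<mu>\<^sub>2 a b c q :: real
  assumes "\<mu>\<^sub>1 > 0" and "\<mu>\<^sub>2 > 0" and "q > 0"
    and "a > 1" and "b > 1" and "c \<ge> 0"
    and "(a - 1) * (b - 1) \<ge> (c - 1)\<^sup>2"
    and "Q_a \<mu>\<^sub>1 \<mu>\<^sub>2 a b c q > \<bar>\<zeta>_a \<mu>\<^sub>1 \<mu>\<^sub>2 a b c q\<bar>"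
    and "Q_b \<mu>\<^sub>1 \<mu>\<^sub>2 a b c q > \<bar>\<zeta>_b \<mu>\<^sub>1 \<mu>\<^sub>2 a b c q\<bar>"
  shows "let \<theta> = (\<mu>\<^sub>1, \<mu>\<^sub>2, a * \<mu>\<^sub>1\<^sup>2, b * \<mu>\<^sub>2\<^sup>2, c * \<mu>\<^sub>1 * \<mu>\<^sub>2);
             Qc = Q_c \<mu>\<^sub>1 \<mu>\<^sub>2 a b c q;
             Ua = U_a \<mu>\<^sub>1 \<mu>\<^sub>2 a b c q; Va = V_a \<mu>\<^sub>1 \<mu>\<^sub>2 a b c q;
             Ub = U_b \<mu>\<^sub>1 \<mu>\<^sub>2 a b c q; Vb = V_b \<mu>\<^sub>1 \<mu>\<^sub>2 a b c q;
             Uc = U_c \<mu>\<^sub>1 \<mu>\<^sub>2 a b c q; Vc = V_c \<mu>\<^sub>1 \<mu>\<^sub>2 a b c q;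
             T0 = t\<^sub>0 \<mu>\<^sub>1 \<mu>\<^sub>2 a b c q; T1 = t\<^sub>1 \<mu>\<^sub>1 \<mu>\<^sub>2 a b c q; T2 = t\<^sub>2 \<mu>\<^sub>1 \<mu>\<^sub>2 a b c q;
             x1 = ((1 - T0) * (Ua / Uc) * \<mu>\<^sub>1, T1);
             x2 = (q - Qc, 0);
             x3 = (0, q + Qc);
             x4 = (T2, (1 - T0) * (Vb / Vc) * \<mu>\<^sub>2);
             p1 = Ub * \<mu>\<^sub>2 / (2 * Qc * T1);
             p2 = Ua * \<mu>\<^sub>1 / (2 * Qc * T1) * T0;
             p3 = Vb * \<mu>\<^sub>2 / (2 * Qc * T2) * T0;
             p4 = Va * \<mu>\<^sub>1 / (2 * Qc * T2);
             atoms = [(x1, p1), (x2, p2), (x3, p3), (x4, p4)]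
         in pmf_of_list_wf atoms \<and>
            optimal_distribution q \<theta> (discrete_law atoms) \<and>
            v_P q \<theta> = ereal (Vc / 2)"
proof -
  define Q where "Q = Q_c \<mu>\<^sub>1 \<mu>\<^sub>2 a b c q"
  define Ua where "Ua = U_a \<mu>\<^sub>1 \<mu>\<^sub>2 a b c q"
  define Va where "Va = V_a \<mu>\<^sub>1 \<mu>\<^sub>2 a b c q"
  define Ub where "Ub = U_b \<mu>\<^sub>1 \<mu>\<^sub>2 a b c q"
  define Vb where "Vb = V_b \<mu>\<^sub>1 \<mu>\<^sub>2 a b c q"
  define Uc where "Uc = U_c \<mu>\<^sub>1 \<mu>\<^sub>2 a b c q"
  define Vc where "Vc = V_c \<mu>\<^sub>1 \<mu>\<^sub>2 a b c q"
  define T0 where "T0 = t\<^sub>0 \<mu>\<^sub>1 \<mu>\<^sub>2 a b c q"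
  define T1 where "T1 = t\<^sub>1 \<mu>\<^sub>1 \<mu>\<^sub>2 a b c q"
  define T2 where "T2 = t\<^sub>2 \<mu>\<^sub>1 \<mu>\<^sub>2 a b c q"
  define \<theta> where "\<theta> = (\<mu>\<^sub>1, \<mu>\<^sub>2, a * \<mu>\<^sub>1\<^sup>2, b * \<mu>\<^sub>2\<^sup>2, c * \<mu>\<^sub>1 * \<mu>\<^sub>2)"
  define u where "u = (1 - T0) * (Ua / Uc) * \<mu>\<^sub>1"
  define w where "w = (1 - T0) * (Vb / Vc) * \<mu>\<^sub>2"
  define p1 where "p1 = Ub * \<mu>\<^sub>2 / (2 * Q * T1)"
  define p2 where "p2 = Ua * \<mu>\<^sub>1 / (2 * Q * T1) * T0"
  define p3 where "p3 = Vb * \<mu>\<^sub>2 / (2 * Q * T2) * T0"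
  define p4 where "p4 = Va * \<mu>\<^sub>1 / (2 * Q * T2)"
  define xs where "xs = [((u, T1), p1), ((q - Q, 0), p2), ((0, q + Q), p3), ((T2, w), p4)]"
  note UV = Ua_def Va_def Ub_def Vb_def Uc_def Vc_def
    U_a_def V_a_def U_b_def V_b_def U_c_def V_c_def Q_def[symmetric]

  \<comment> \<open>Positivity of the constants\<close>
  have \<zeta>a: "\<bar>a * \<mu>\<^sub>1 + c * \<mu>\<^sub>2 - q\<bar> < Q"
    using Q_c_dominates_\<zeta>_a[OF assms(4,8)] by (simp add: Q_def \<zeta>_a_def)
  have \<zeta>b: "\<bar>c * \<mu>\<^sub>1 + b * \<mu>\<^sub>2 - q\<bar> < Q"
    using Q_c_dominates_\<zeta>_b[OF assms(5,9)] by (simp add: Q_def \<zeta>_b_def)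
  have Qpos: "Q > 0"
    using \<zeta>a by linarith
  have Qsq: "Q\<^sup>2 = q\<^sup>2 - 2 * q * (\<mu>\<^sub>1 + \<mu>\<^sub>2) + a * \<mu>\<^sub>1\<^sup>2 + b * \<mu>\<^sub>2\<^sup>2 + 2 * c * \<mu>\<^sub>1 * \<mu>\<^sub>2"
    using Q_c_squared Qpos unfolding Q_def by blast
  have "\<bar>\<mu>\<^sub>1 + \<mu>\<^sub>2 - q\<bar> < Q"
    by (rule abs_mean_diff_less[OF assms(4,7) \<zeta>a Qsq])
  with \<zeta>a \<zeta>b have pos: "Ua > 0" "Va > 0" "Ub > 0" "Vb > 0" "Uc > 0" "Vc > 0"
    unfolding UV by (auto simp: abs_less_iff algebra_simps)

  \<comment> \<open>\<open>Ua * \<mu>\<^sub>1\<close> is \<open>E[(q + Q - S) * X\<^sub>1]\<close>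
    with \<open>S = X\<^sub>1 + X\<^sub>2\<close>. The weight \<open>q + Q - S\<close> is
    \<open>2 * Q\<close> on the lower line \<open>S = q - Q\<close> and 0 on the upper line
    \<open>S = q + Q\<close>. For a law on both lines, \<open>Ua * \<mu>\<^sub>1 / (2 * Q)\<close>
    is thus the lower line's share of \<open>E[X\<^sub>1]\<close> and \<open>Uc / (2 * Q)\<close>
    its mass; \<open>U_eq\<close> evaluates the share of \<open>E[S]\<close>. The \<open>V\<close>
    constants play the same role for the upper line.\<close>
  have U_eq: "(q - Q) * Uc = Ua * \<mu>\<^sub>1 + Ub * \<mu>\<^sub>2"
    and V_eq: "(q + Q) * Vc = Va * \<mu>\<^sub>1 + Vb * \<mu>\<^sub>2"
    using Qsq unfolding UV by (auto simp: power2_eq_square algebra_simps)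
  have "(q - Q) * Uc > 0"
    unfolding U_eq using pos assms(1,2) by (simp add: add_pos_pos)
  then have qQ: "q - Q > 0"
    using pos by (simp add: zero_less_mult_iff)

  \<comment> \<open>The parameter \<open>t\<^sub>0\<close>\<close>
  define d where "d = ((a - 1) * (b - 1) - (c - 1)\<^sup>2) * (\<mu>\<^sub>1 * \<mu>\<^sub>2)\<^sup>2"
  define D where "D = d + c * \<mu>\<^sub>1 * \<mu>\<^sub>2 * (Uc * Vc)"
  have T0_eq: "T0 = d / D"
    by (simp add: T0_def t\<^sub>0_def det_cov_matrix d_def D_def Uc_def Vc_def)
  have UaUb: "Ua * Ub * Vc + Va * Vb * Uc =
      2 * Q * (((a - 1) * (b - 1) - (c - 1)\<^sup>2) * \<mu>\<^sub>1 * \<mu>\<^sub>2 + c * (Uc * Vc))"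
  proof -
    have "Ua = Q - (a * \<mu>\<^sub>1 + c * \<mu>\<^sub>2 - q)" "Va = Q + (a * \<mu>\<^sub>1 + c * \<mu>\<^sub>2 - q)"
      "Ub = Q - (b * \<mu>\<^sub>2 + c * \<mu>\<^sub>1 - q)" "Vb = Q + (b * \<mu>\<^sub>2 + c * \<mu>\<^sub>1 - q)"
      "Uc = Q - (\<mu>\<^sub>1 + \<mu>\<^sub>2 - q)" "Vc = Q + (\<mu>\<^sub>1 + \<mu>\<^sub>2 - q)"
      unfolding UV by auto
    then show ?thesis
      using mixed_moment_identity[OF Qsq] by simp
  qed
  have D_eq: "2 * Q * D = \<mu>\<^sub>1 * \<mu>\<^sub>2 * (Ua * Ub * Vc + Va * Vb * Uc)"
    unfolding UaUb D_def d_def by (simp add: power2_eq_square algebra_simps)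
  \<comment> \<open>Both summands of \<open>D\<close> are merely nonnegative by themselves; strict
    positivity comes from the product form.\<close>
  have "2 * Q * D > 0"
    unfolding D_eq using pos assms(1,2) by (simp add: add_pos_pos)
  then have Dpos: "D > 0"
    using Qpos by (simp add: zero_less_mult_iff)
  have dnonneg: "d \<ge> 0"
    using assms(7) by (simp add: d_def)
  have "d \<le> D"
    using pos assms(1,2,6) by (simp add: D_def)
  then have T0: "0 \<le> T0" "T0 \<le> 1"
    using dnonneg Dpos by (auto simp: T0_eq)
  have T0': "(1 - T0) * D = c * \<mu>\<^sub>1 * \<mu>\<^sub>2 * (Uc * Vc)"
    using Dpos by (simp add: T0_eq field_simps D_def)

  \<comment> \<open>Atoms and weights\<close>
  have T1_eq: "T1 = (Ub * \<mu>\<^sub>2 + T0 * Ua * \<mu>\<^sub>1) / Uc"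
    by (simp add: T1_def t\<^sub>1_def Ua_def Ub_def Uc_def T0_def add_divide_distrib)
  have T2_eq: "T2 = (Va * \<mu>\<^sub>1 + T0 * Vb * \<mu>\<^sub>2) / Vc"
    by (simp add: T2_def t\<^sub>2_def Va_def Vb_def Vc_def T0_def add_divide_distrib)
  have Tpos: "T1 > 0" "T2 > 0"
    unfolding T1_eq T2_eq using pos assms(1,2) T0 by (simp_all add: add_pos_nonneg)
  \<comment> \<open>The first atom lies on the lower line and, by \<open>w_eq\<close>, the last one
    on the upper line.\<close>
  have u_eq: "u = q - Q - T1"
    using U_eq pos by (simp add: u_def T1_eq field_simps)
  have w_eq: "w = q + Q - T2"
    using V_eq pos by (simp add: w_def T2_eq field_simps)
  have uw_nonneg: "u \<ge> 0" "w \<ge> 0"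
    unfolding u_def w_def using pos assms(1,2) T0 by simp_all

  have p_nonneg: "p1 \<ge> 0" "p2 \<ge> 0" "p3 \<ge> 0" "p4 \<ge> 0"
    unfolding p1_def p2_def p3_def p4_def using pos assms(1,2) T0 Tpos Qpos by simp_all
  have "p1 + p2 = (Uc * T1) / (2 * Q * T1)"
    using pos by (simp add: p1_def p2_def T1_eq add_divide_distrib algebra_simps)
  then have p12: "p1 + p2 = Uc / (2 * Q)"
    using Tpos by simp
  have "p3 + p4 = (Vc * T2) / (2 * Q * T2)"
    using pos by (simp add: p3_def p4_def T2_eq add_divide_distrib algebra_simps)
  then have p34: "p3 + p4 = Vc / (2 * Q)"
    using Tpos by simp
  have UV_add: "Ua + Va = 2 * Q" "Ub + Vb = 2 * Q" "Uc + Vc = 2 * Q"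
    unfolding UV by auto
  have p_sum: "p1 + p2 + p3 + p4 = 1"
  proof -
    have "p1 + p2 + p3 + p4 = (Uc + Vc) / (2 * Q)"
      using p12 p34 by (simp add: add_divide_distrib)
    then show ?thesis
      using UV_add Qpos by simp
  qed
  have wf: "pmf_of_list_wf xs"
    unfolding pmf_of_list_wf_def xs_def using p_nonneg p_sum by (simp add: add.assoc)

  \<comment> \<open>\<open>e1\<close> to \<open>e4\<close> are the shares of the two means carried
    by each line. The axis atoms contribute nothing to \<open>e1\<close> and \<open>e4\<close>;
    \<open>e2\<close> and \<open>e3\<close> follow because the coordinate sum is constant on a
    line.\<close>
  have e1: "p1 * T1 = Ub * \<mu>\<^sub>2 / (2 * Q)" and e4: "p4 * T2 = Va * \<mu>\<^sub>1 / (2 * Q)"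
    using Tpos by (simp_all add: p1_def p4_def)
  have e2: "u * p1 + (q - Q) * p2 = Ua * \<mu>\<^sub>1 / (2 * Q)"
  proof -
    have "u * p1 + (q - Q) * p2 = (q - Q) * (p1 + p2) - p1 * T1"
      by (simp add: u_eq algebra_simps)
    also have "\<dots> = ((q - Q) * Uc - Ub * \<mu>\<^sub>2) / (2 * Q)"
      unfolding p12 e1 by (simp add: diff_divide_distrib)
    finally show ?thesis
      by (simp add: U_eq)
  qed
  have e3: "w * p4 + (q + Q) * p3 = Vb * \<mu>\<^sub>2 / (2 * Q)"
  proof -
    have "w * p4 + (q + Q) * p3 = (q + Q) * (p3 + p4) - p4 * T2"
      by (simp add: w_eq algebra_simps)
    also have "\<dots> = ((q + Q) * Vc - Va * \<mu>\<^sub>1) / (2 * Q)"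
      unfolding p34 e4 by (simp add: diff_divide_distrib)
    finally show ?thesis
      by (simp add: V_eq)
  qed

  \<comment> \<open>The five moments\<close>
  have m1: "u * p1 + (q - Q) * p2 + T2 * p4 = \<mu>\<^sub>1"
  proof -
    have "u * p1 + (q - Q) * p2 + T2 * p4 = (Ua + Va) * \<mu>\<^sub>1 / (2 * Q)"
      using e2 e4 by (simp add: algebra_simps add_divide_distrib)
    then show ?thesis
      using UV_add Qpos by simp
  qed
  have m2: "T1 * p1 + (q + Q) * p3 + w * p4 = \<mu>\<^sub>2"
  proof -
    have "T1 * p1 + (q + Q) * p3 + w * p4 = (Ub + Vb) * \<mu>\<^sub>2 / (2 * Q)"
      using e1 e3 by (simp add: algebra_simps add_divide_distrib)
    then show ?thesis
      using UV_add Qpos by simp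
  qed
  have m12: "u * T1 * p1 + T2 * w * p4 = c * \<mu>\<^sub>1 * \<mu>\<^sub>2"
  proof -
    \<comment> \<open>The axis atoms have zero product of coordinates, so the mixed moment is
      \<open>1 - T0\<close> times its value at \<open>T0 = 0\<close>; \<open>T0'\<close> says that
      this factor gives the prescribed value.\<close>
    have "u * T1 * p1 + T2 * w * p4 = u * (p1 * T1) + w * (p4 * T2)"
      by simp
    also have "\<dots> = (1 - T0) * (\<mu>\<^sub>1 * \<mu>\<^sub>2 * (Ua * Ub * Vc + Va * Vb * Uc)) / (2 * Q * Uc * Vc)"
      unfolding e1 e4 u_def w_def using pos Qpos by (simp add: field_simps)
    also have "\<dots> = ((1 - T0) * D) / (Uc * Vc)"
      unfolding D_eq[symmetric] using Qpos by simp
    also have "\<dots> = c * \<mu>\<^sub>1 * \<mu>\<^sub>2"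
      unfolding T0' using pos by simp
    finally show ?thesis .
  qed
  have s1: "u\<^sup>2 * p1 + (q - Q)\<^sup>2 * p2 + T2\<^sup>2 * p4 = a * \<mu>\<^sub>1\<^sup>2"
  proof -
    \<comment> \<open>Adding the mixed moment gives
      \<open>E[X\<^sub>1 * (X\<^sub>1 + X\<^sub>2)]\<close>, where the second factor is constant on
      each line, so the shares \<open>e2\<close> and \<open>e4\<close> suffice. The computation for
      \<open>s2\<close> is the same with \<open>e1\<close> and \<open>e3\<close>.\<close>
    have "u\<^sup>2 * p1 + (q - Q)\<^sup>2 * p2 + T2\<^sup>2 * p4 + (u * T1 * p1 + T2 * w * p4) =
        (q - Q) * (u * p1 + (q - Q) * p2) + (q + Q) * (p4 * T2)"
      by (simp add: u_eq w_eq power2_eq_square algebra_simps)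
    also have "\<dots> = (q * (Ua + Va) + Q * (Va - Ua)) * \<mu>\<^sub>1 / (2 * Q)"
      unfolding e2 e4 by (simp add: add_divide_distrib diff_divide_distrib algebra_simps)
    also have "q * (Ua + Va) + Q * (Va - Ua) = 2 * Q * (a * \<mu>\<^sub>1 + c * \<mu>\<^sub>2)"
      unfolding UV by (simp add: algebra_simps)
    also have "2 * Q * (a * \<mu>\<^sub>1 + c * \<mu>\<^sub>2) * \<mu>\<^sub>1 / (2 * Q) = (a * \<mu>\<^sub>1 + c * \<mu>\<^sub>2) * \<mu>\<^sub>1"
      using Qpos by simp
    finally show ?thesis
      using m12 by (simp add: power2_eq_square algebra_simps)
  qed
  have s2: "T1\<^sup>2 * p1 + (q + Q)\<^sup>2 * p3 + w\<^sup>2 * p4 = b * \<mu>\<^sub>2\<^sup>2"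
  proof -
    have "T1\<^sup>2 * p1 + (q + Q)\<^sup>2 * p3 + w\<^sup>2 * p4 + (u * T1 * p1 + T2 * w * p4) =
        (q - Q) * (p1 * T1) + (q + Q) * (w * p4 + (q + Q) * p3)"
      by (simp add: u_eq w_eq power2_eq_square algebra_simps)
    also have "\<dots> = (q * (Ub + Vb) + Q * (Vb - Ub)) * \<mu>\<^sub>2 / (2 * Q)"
      unfolding e1 e3 by (simp add: add_divide_distrib diff_divide_distrib algebra_simps)
    also have "q * (Ub + Vb) + Q * (Vb - Ub) = 2 * Q * (b * \<mu>\<^sub>2 + c * \<mu>\<^sub>1)"
      unfolding UV by (simp add: algebra_simps)
    also have "2 * Q * (b * \<mu>\<^sub>2 + c * \<mu>\<^sub>1) * \<mu>\<^sub>2 / (2 * Q) = (b * \<mu>\<^sub>2 + c * \<mu>\<^sub>1) * \<mu>\<^sub>2"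
      using Qpos by simp
    finally show ?thesis
      using m12 by (simp add: power2_eq_square algebra_simps)
  qed

  \<comment> \<open>Attainment and optimality\<close>
  have mem: "discrete_law xs \<in> moment_class \<theta>"
    unfolding \<theta>_def
    by (rule discrete_law_in_moment_class[OF wf])
      (use uw_nonneg Tpos qQ Qpos assms(3) m1 m2 s1 s2 m12 in \<open>auto simp: xs_def add.assoc\<close>)
  \<comment> \<open>The excess is 0 on the lower line and \<open>Q\<close> on the upper one.\<close>
  have "expected_excess q (discrete_law xs) = Q * (p3 + p4)"
    unfolding expected_excess_discrete_law[OF wf]
    using Qpos by (simp add: xs_def u_eq w_eq algebra_simps)
  then have val: "expected_excess q (discrete_law xs) = Vc / 2"
    using p34 Qpos by simp
  have bound: "expected_excess q P \<le> Vc / 2" if "P \<in> moment_class \<theta>" for P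
    using expected_excess_le[OF that[unfolded \<theta>_def] Qpos] Qsq
    by (simp add: Vc_def V_c_def Q_def mult.assoc)
  have "v_P q \<theta> = ereal (Vc / 2)"
    unfolding v_P_def
  proof (rule antisym)
    show "(SUP P\<in>moment_class \<theta>. ereal (expected_excess q P)) \<le> ereal (Vc / 2)"
      by (intro SUP_least ereal_less_eq(3)[THEN iffD2] bound)
    show "ereal (Vc / 2) \<le> (SUP P\<in>moment_class \<theta>. ereal (expected_excess q P))"
      using SUP_upper[OF mem, of "\<lambda>P. ereal (expected_excess q P)"] by (simp add: val)
  qed
  with wf mem val have "pmf_of_list_wf xs \<and> optimal_distribution q \<theta> (discrete_law xs) \<and>
      v_P q \<theta> = ereal (Vc / 2)"
    by (simp add: optimal_distribution_def)
  then show ?thesis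
    unfolding Let_def xs_def \<theta>_def u_def w_def p1_def p2_def p3_def p4_def
      Ua_def Va_def Ub_def Vb_def Uc_def Vc_def T0_def T1_def T2_def Q_def .
qed

end
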